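(* Let $G=(V,E)$ be a finite connected loopless graph and $D$ a coherent acyclic orientation of a cut subgraph of $G$; let $X_1,\dots,X_{d+1}$ be the connected components of the spanning subgraph of $G$ with edge set $E$ minus the edges oriented by $D$. Let $\pi_F\colon C^1(G,\mathbb{R})\to F_\mathbb{R}$ be the orthogonal projection. Then: (1) $\pi_F(\square_{D,0})=\mathfrak{f}_D$; (2) $\pi_F$ maps the relative interior of $\square_{D,0}$ onto the relative interior of $\mathfrak{f}_D$; (3) $\pi_F$ induces an isomorphism (bijection) from $\mathrm{Vor}_{F_1}(O)+\dots+\mathrm{Vor}_{F_{d+1}}(O)+\frac12\chi_D$ onto $\mathfrak{f}_D$.
   Context: $\mathbb{E}$: oriented edges of $G$; $C^1(G,A)$: $x\colon\mathbb{E}\to A$ with $x_{\bar e}=-x_e$; $d(f)(uv)=f(v)-f(u)$; $F_A=d(C^0(G,A))$; inner product $\langle x,y\rangle=\sum_{e\in E}x_ey_e$ (each edge once), norm $\|\cdot\|$; $\mathrm{Vor}_F(O)=\{x\in F_\mathbb{R}:\|x\|\le\|x-\alpha\|\ \forall\alpha\in F_\mathbb{Z}\}$. An orientation $D$ is coherent acyclic of a cut subgraph if there is a partition $V_1,\dots,V_s$ of $V$ such that $D$ orients exactly the edges joining different parts, from $V_i$ to $V_j$ when $i<j$; $\mathbb{E}(D)$ denotes its oriented edges. $\chi_D\in C^1(G,\mathbb{Z})$ is $+1$ on $\mathbb{E}(D)$, $-1$ on reverses of elements of $\mathbb{E}(D)$, $0$ elsewhere. $\square_{D,0}=\{x\in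 C^1(G,\mathbb{R}): x_e=\frac12\text{ for }e\in\mathbb{E}(D),\ |x_e|\le\frac12\text{ for all }e\}$. A bond element is $d(\chi_C)$ with $C$ a proper nonempty subset of $V$ such that the induced subgraphs $G[C]$, $G[V-C]$ are connected; its positive support is $\{e\in\mathbb{E}: d(\chi_C)_e>0\}$. $\mathfrak{f}_D:=\mathrm{Vor}_F(O)\cap\{x\in F_\mathbb{R}:2\langle x,\beta\rangle=\|\beta\|^2\text{ for every bond element }\beta\text{ with positive support contained in }\mathbb{E}(D)\}$; it is the face of $\mathrm{Vor}_F(O)$ corresponding to $D$. For each $i$, $F_{i,\mathbb{R}}$ and $F_{i,\mathbb{Z}}$ are the cut space and cut lattice of $X_i$ (images of $d$ for $X_i$), $\mathrm{Vor}_{F_i}(O)$ is the Voronoi cell of the origin of $F_{i,\mathbb{Z}}$ in $F_{i,\mathbb{R}}$, viewed inside $C^1(G,\mathbb{R})$ via extension by zero. *)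

theory Defs
  imports "HOL-Analysis.Analysis" "Graph_Theory.Graph_Theory"
begin

text \<open>
  A finite graph, possibly with multiple edges, is a \<^const>\<open>bidirected_digraph\<close>: its arcs are the
  oriented edges and \<open>arev\<close> is the fixed-point free involution on arcs sending \<open>e\<close> to its reverse.
  An (unoriented) edge is thus a pair \<open>{e, arev e}\<close>.

  Functions on oriented edges are vectors in \<open>real ^ 'e\<close> vanishing outside \<open>arcs G\<close>. With this
  convention the cochains of a subgraph are cochains of \<open>G\<close>, and extension by zero is the identity.
\<close>

definition cochains0 :: "('v, 'e) pre_digraph \<Rightarrow> real set \<Rightarrow> ('v \<Rightarrow> real) set" where
  "cochains0 G A = (verts G \<rightarrow> A)"

definition cochains1 ::
  "('v, 'e::finite) pre_digraph \<Rightarrow> ('e \<Rightarrow> 'e) \<Rightarrow> real set \<Rightarrow> (real ^ 'e) set" where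
  "cochains1 G arev A =
     {x. (\<forall>e\<in>arcs G. x $ e \<in> A \<and> x $ arev e = - x $ e) \<and> (\<forall>e. e \<notin> arcs G \<longrightarrow> x $ e = 0)}"

definition coboundary :: "('v, 'e::finite) pre_digraph \<Rightarrow> ('v \<Rightarrow> real) \<Rightarrow> real ^ 'e" where
  "coboundary G f = (\<chi> e. if e \<in> arcs G then f (head G e) - f (tail G e) else 0)"

definition cut_space :: "('v, 'e::finite) pre_digraph \<Rightarrow> real set \<Rightarrow> (real ^ 'e) set" where
  "cut_space G A = coboundary G ` cochains0 G A"

text \<open>
  The factor \<open>1/2\<close> makes each edge count once, since \<open>e\<close> and \<open>arev e\<close> contribute the same product;
  see \<open>edge_inner_orientation\<close> below.
\<close>

definition edge_inner ::
  "('v, 'e::finite) pre_digraph \<Rightarrow> real ^ 'e \<Rightarrow> real ^ 'e \<Rightarrow> real" where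
  "edge_inner G x y = (\<Sum>e\<in>arcs G. x $ e * y $ e) / 2"

definition edge_norm :: "('v, 'e::finite) pre_digraph \<Rightarrow> real ^ 'e \<Rightarrow> real" where
  "edge_norm G x = sqrt (edge_inner G x x)"

definition voronoi_cell :: "('v, 'e::finite) pre_digraph \<Rightarrow> (real ^ 'e) set" where
  "voronoi_cell G =
     {x \<in> cut_space G UNIV. \<forall>\<alpha>\<in>cut_space G \<int>. edge_norm G x \<le> edge_norm G (x - \<alpha>)}"

definition cut_projection :: "('v, 'e::finite) pre_digraph \<Rightarrow> real ^ 'e \<Rightarrow> real ^ 'e" where
  "cut_projection G x =
     (THE y. y \<in> cut_space G UNIV \<and> (\<forall>z\<in>cut_space G UNIV. edge_inner G (x - y) z = 0))"

text \<open>An orientation \<open>D\<close> of a subgraph is represented by its set of oriented edges.\<close>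

definition coherent_acyclic :: "('v, 'e) pre_digraph \<Rightarrow> 'e set \<Rightarrow> bool" where
  "coherent_acyclic G D \<longleftrightarrow>
     (\<exists>(s::nat) P. (\<forall>i\<in>{1..s}. P i \<noteq> {}) \<and> disjoint_family_on P {1..s} \<and>
        (\<Union>i\<in>{1..s}. P i) = verts G \<and>
        D = {e \<in> arcs G. \<exists>i\<in>{1..s}. \<exists>j\<in>{1..s}. i < j \<and> tail G e \<in> P i \<and> head G e \<in> P j})"

definition orientation_char :: "('e::finite \<Rightarrow> 'e) \<Rightarrow> 'e set \<Rightarrow> real ^ 'e" where
  "orientation_char arev D = (\<chi> e. if e \<in> D then 1 else if arev e \<in> D then - 1 else 0)"

definition cube_face ::
  "('v, 'e::finite) pre_digraph \<Rightarrow> ('e \<Rightarrow> 'e) \<Rightarrow> 'e set \<Rightarrow> (real ^ 'e) set" where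
  "cube_face G arev D =
     {x \<in> cochains1 G arev UNIV. (\<forall>e\<in>D. x $ e = 1/2) \<and> (\<forall>e\<in>arcs G. \<bar>x $ e\<bar> \<le> 1/2)}"

definition bond_elements :: "('v, 'e::finite) pre_digraph \<Rightarrow> (real ^ 'e) set" where
  "bond_elements G =
     {coboundary G (indicator C) | C. C \<noteq> {} \<and> C \<subset> verts G \<and>
        Digraph_Component.connected (G \<restriction> C) \<and>
        Digraph_Component.connected (G \<restriction> (verts G - C))}"

definition positive_support :: "('v, 'e::finite) pre_digraph \<Rightarrow> real ^ 'e \<Rightarrow> 'e set" where
  "positive_support G x = {e \<in> arcs G. x $ e > 0}"

definition voronoi_face :: "('v, 'e::finite) pre_digraph \<Rightarrow> 'e set \<Rightarrow> (real ^ 'e) set" where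
  "voronoi_face G D = voronoi_cell G \<inter>
     {x \<in> cut_space G UNIV.
        \<forall>\<beta>\<in>bond_elements G. positive_support G \<beta> \<subseteq> D \<longrightarrow>
          2 * edge_inner G x \<beta> = (edge_norm G \<beta>)\<^sup>2}"

definition remove_oriented ::
  "('v, 'e) pre_digraph \<Rightarrow> ('e \<Rightarrow> 'e) \<Rightarrow> 'e set \<Rightarrow> ('v, 'e) pre_digraph" where
  "remove_oriented G arev D = G\<lparr>arcs := arcs G - (D \<union> arev ` D)\<rparr>"

definition components_of :: "('v, 'e) pre_digraph \<Rightarrow> ('v, 'e) pre_digraph set" where
  "components_of G = {X. pre_digraph.max_subgraph G Digraph_Component.connected X}"

lemma edge_inner_orientation:
  fixes G :: "('v, 'e::finite) pre_digraph"
  assumes "bidirected_digraph G arev"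
    and R: "R \<subseteq> arcs G" "\<And>e. e \<in> arcs G \<Longrightarrow> (e \<in> R) \<noteq> (arev e \<in> R)"
    and x: "x \<in> cochains1 G arev UNIV" and y: "y \<in> cochains1 G arev UNIV"
  shows "edge_inner G x y = (\<Sum>e\<in>R. x $ e * y $ e)"
proof -
  interpret bidirected_digraph G arev by fact
  have "e \<in> arev ` R" if "e \<in> arcs G" "e \<notin> R" for e
    using R(2)[OF that(1)] that(2) by (intro image_eqI[of _ _ "arev e"]) auto
  then have arcs: "arcs G = R \<union> arev ` R"
    using R(1) by auto
  have disj: "R \<inter> arev ` R = {}"
    using R by blast
  have inj: "inj_on arev R"
    by (rule inj_on_inverseI[of _ arev]) simp
  have "(\<Sum>e\<in>arev ` R. x $ e * y $ e) = (\<Sum>e\<in>R. x $ e * y $ e)"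
    using R(1) x y by (subst sum.reindex[OF inj]) (auto simp: cochains1_def intro!: sum.cong)
  then show ?thesis
    by (simp add: edge_inner_def arcs sum.union_disjoint disj)
qed

lemma subspace_cut_space: "subspace (cut_space G UNIV)"
proof -
  have add: "coboundary G f + coboundary G g = coboundary G (\<lambda>v. f v + g v)"
    and scale: "c *\<^sub>R coboundary G f = coboundary G (\<lambda>v. c * f v)"
    and zero: "0 = coboundary G (\<lambda>_. 0)" for f g c
    by (auto simp: coboundary_def vec_eq_iff algebra_simps)
  have F: "cut_space G UNIV = range (coboundary G)"
    by (simp add: cut_space_def cochains0_def)
  show ?thesis
    unfolding subspace_def F
  proof (intro conjI ballI allI)
    show "0 \<in> range (coboundary G)"
      by (subst zero) (rule rangeI)
  qed (force simp only: add scale)+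
qed

lemma edge_inner_cut:
  fixes G :: "('v, 'e::finite) pre_digraph"
  assumes "z \<in> cut_space G UNIV"
  shows "edge_inner G x z = (x \<bullet> z) / 2"
proof -
  have "z $ e = 0" if "e \<notin> arcs G" for e
    using assms that by (auto simp: cut_space_def coboundary_def)
  then have "(\<Sum>e\<in>arcs G. x $ e * z $ e) = (\<Sum>e\<in>UNIV. x $ e * z $ e)"
    by (intro sum.mono_neutral_left) auto
  then show ?thesis
    by (simp add: edge_inner_def inner_vec_def)
qed

lemma cut_projection_ex1:
  "\<exists>!y. y \<in> cut_space G UNIV \<and> (\<forall>z\<in>cut_space G UNIV. edge_inner G (x - y) z = 0)"
proof -
  let ?F = "cut_space G UNIV"
  obtain y w where yw: "y \<in> span ?F" "\<And>z. z \<in> span ?F \<Longrightarrow> orthogonal w z" "x = y + w"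
    using orthogonal_subspace_decomp_exists[of ?F x] by metis
  show ?thesis
  proof (rule ex1I[of _ y])
    show "y \<in> ?F \<and> (\<forall>z\<in>?F. edge_inner G (x - y) z = 0)"
      using yw by (auto simp: edge_inner_cut orthogonal_def span_eq_iff[THEN iffD2, OF subspace_cut_space])
  next
    fix y' assume y': "y' \<in> ?F \<and> (\<forall>z\<in>?F. edge_inner G (x - y') z = 0)"
    have F: "y - y' \<in> ?F"
      using y' yw(1) by (simp add: span_eq_iff[THEN iffD2, OF subspace_cut_space] subspace_diff subspace_cut_space)
    have "(x - y') \<bullet> (y - y') = 0" "w \<bullet> (y - y') = 0"
      using y' F yw(2)[OF span_base[OF F]] by (auto simp: edge_inner_cut orthogonal_def)
    then have "(y - y') \<bullet> (y - y') = 0"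
      using yw(3) by (simp add: inner_diff_left inner_add_left algebra_simps)
    then show "y' = y" by simp
  qed
qed

lemma cut_projection:
  shows cut_projection_in: "cut_projection G x \<in> cut_space G UNIV"
    and cut_projection_orth: "z \<in> cut_space G UNIV \<Longrightarrow> edge_inner G (x - cut_projection G x) z = 0"
  using theI'[OF cut_projection_ex1[of G x]] unfolding cut_projection_def by blast+

lemma cut_projection_unique:
  assumes "y \<in> cut_space G UNIV" "\<And>z. z \<in> cut_space G UNIV \<Longrightarrow> edge_inner G (x - y) z = 0"
  shows "cut_projection G x = y"
  using cut_projection_ex1[of G x] cut_projection assms by blast

lemma linear_cut_projection: "linear (cut_projection G)"
proof (rule linearI)
  fix x y and c :: real
  show "cut_projection G (x + y) = cut_projection G x + cut_projection G y"
  proof (rule cut_projection_unique)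
    fix z assume z: "z \<in> cut_space G UNIV"
    show "edge_inner G (x + y - (cut_projection G x + cut_projection G y)) z = 0"
      using cut_projection_orth[OF z, of x] cut_projection_orth[OF z, of y]
      by (simp add: edge_inner_cut[OF z] inner_diff_left inner_add_left)
  qed (simp add: subspace_add[OF subspace_cut_space] cut_projection_in)
  show "cut_projection G (c *\<^sub>R x) = c *\<^sub>R cut_projection G x"
  proof (rule cut_projection_unique)
    fix z assume z: "z \<in> cut_space G UNIV"
    show "edge_inner G (c *\<^sub>R x - c *\<^sub>R cut_projection G x) z = 0"
      using cut_projection_orth[OF z, of x]
      by (simp add: edge_inner_cut[OF z] inner_diff_left)
  qed (simp add: subspace_scale[OF subspace_cut_space] cut_projection_in)
qed

end

theory Submission
  imports Defs
begin

text \<open>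
  For \<open>D = {}\<close>, the projection of the cube lies in the Voronoi cell because \<open>\<bar>a\<bar> \<le> a\<^sup>2\<close> for
  integers. Conversely, a point outside the projection is separated from it by some coboundary of
  a function \<open>f\<close>; decomposing \<open>f\<close> into indicators of its level sets, one of the corresponding cuts
  violates the Voronoi inequality. For general \<open>D\<close>, every arc of \<open>D\<close> lies on a bond with positive
  support in \<open>D\<close>, and equality in the Voronoi inequality for that bond forces the value \<open>1/2\<close>
  on the arc. For the bijection, let \<open>H\<close> be \<open>G\<close> without the edges of \<open>D\<close>. Its Voronoi cell is the
  sum of those of its components, and a cochain supported on \<open>H\<close> has the same inner product
  with the coboundaries of \<open>f\<close> in \<open>G\<close> and in \<open>H\<close>. Hence projecting to the cut space of \<open>H\<close> first
  does not change the projection to that of \<open>G\<close>, and the latter is injective on the cut space of \<open>H\<close>.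
\<close>

section \<open>Connectedness and components through saturated vertex sets\<close>

text \<open>For a well-formed digraph these sets are exactly the unions of vertex sets of connected
  components. They let connectivity be argued without walks.\<close>

definition saturated :: "('v, 'e) pre_digraph \<Rightarrow> 'v set \<Rightarrow> bool" where
  "saturated G S \<longleftrightarrow> S \<subseteq> verts G \<and> (\<forall>e\<in>arcs G. tail G e \<in> S \<longleftrightarrow> head G e \<in> S)"

text \<open>For a vertex \<open>v\<close> this is the vertex set of its component. If
  \<open>v\<close> is not a vertex, the intersection is over the empty family and yields
  \<open>UNIV\<close>, hence the hypotheses \<open>v \<in> verts G\<close> below.\<close>

definition component_verts :: "('v, 'e) pre_digraph \<Rightarrow> 'v \<Rightarrow> 'v set" where
  "component_verts G v = \<Inter>{S. saturated G S \<and> v \<in> S}"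

lemma (in wf_digraph) saturated_compl: "saturated G S \<Longrightarrow> saturated G (verts G - S)"
  by (auto simp: saturated_def)

lemma (in wf_digraph) saturated_verts: "saturated G (verts G)"
  by (auto simp: saturated_def)

text \<open>Connectedness means mutual reachability in the symmetric closure. A saturated set is
  closed under reachability there, and conversely the set of vertices reachable from
  \<open>u\<close> is itself saturated.\<close>

lemma (in wf_digraph) connected_iff_saturated:
  "Digraph_Component.connected G \<longleftrightarrow>
     verts G \<noteq> {} \<and> (\<forall>S. saturated G S \<and> S \<noteq> {} \<longrightarrow> S = verts G)" (is "?L \<longleftrightarrow> ?R")
proof
  interpret M: pair_wf_digraph "mk_symmetric G" by (rule wellformed_mk_symmetric)
  {
    assume L: ?L
    then have ne: "verts G \<noteq> {}"
      by (simp add: Digraph_Component.connected_def strongly_connected_def)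
    have "v \<in> S" if S: "saturated G S" "u \<in> S" and v: "v \<in> verts G" for S u v
    proof -
      have "u \<in> verts G" using S by (auto simp: saturated_def)
      then have "u \<rightarrow>\<^sup>*\<^bsub>mk_symmetric G\<^esub> v"
        using L v by (auto simp: Digraph_Component.connected_def strongly_connected_def)
      then show ?thesis
      proof (induction rule: M.reachable_induct)
        case (step x y)
        then obtain e where "e \<in> arcs G"
            "(x, y) = (tail G e, head G e) \<or> (x, y) = (head G e, tail G e)"
          by (auto simp: parcs_mk_symmetric)
        then show ?case using S(1) step.IH by (auto simp: saturated_def)
      qed (use S in auto)
    qed
    then have "S = verts G" if "saturated G S" "S \<noteq> {}" for S
      using that unfolding saturated_def by blast
    with ne show ?R by blast
  }
  {
    assume R: ?R
    have "u \<rightarrow>\<^sup>*\<^bsub>mk_symmetric G\<^esub> v" if u: "u \<in> verts G" and v: "v \<in> verts G" for u v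
    proof -
      let ?S = "{w. u \<rightarrow>\<^sup>*\<^bsub>mk_symmetric G\<^esub> w}"
      have ends: "tail G e \<rightarrow>\<^bsub>mk_symmetric G\<^esub> head G e" "head G e \<rightarrow>\<^bsub>mk_symmetric G\<^esub> tail G e"
        if "e \<in> arcs G" for e
        using that by (auto simp: parcs_mk_symmetric)
      have "saturated G ?S"
        unfolding saturated_def using ends M.reachable_in_verts(2)
        by (auto intro: M.reachable_adj_trans)
      moreover have "u \<in> ?S" using u by (simp add: M.reachable_refl)
      ultimately show ?thesis using R v by blast
    qed
    then show ?L using R
      by (auto simp: Digraph_Component.connected_def strongly_connected_def)
  }
qed

section \<open>Components as induced subgraphs on least saturated sets, and bonds inside
  cuts\<close>

context wf_digraph
begin

lemma saturated_component_verts: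
  assumes "v \<in> verts G"
  shows "saturated G (component_verts G v)" "v \<in> component_verts G v"
    "component_verts G v \<subseteq> verts G"
proof -
  show "v \<in> component_verts G v" by (auto simp: component_verts_def)
  show sub: "component_verts G v \<subseteq> verts G"
    using saturated_verts assms by (auto simp: component_verts_def)
  have "tail G e \<in> component_verts G v \<longleftrightarrow> head G e \<in> component_verts G v" if "e \<in> arcs G" for e
    using that by (auto simp: component_verts_def saturated_def)
  then show "saturated G (component_verts G v)" using sub by (auto simp: saturated_def)
qed

lemma component_verts_least: "saturated G S \<Longrightarrow> v \<in> S \<Longrightarrow> component_verts G v \<subseteq> S"
  by (auto simp: component_verts_def)

text \<open>A set saturated inside the component is saturated in \<open>G\<close>. If it contains
  \<open>v\<close>, minimality makes it the whole component; otherwise this applies to its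
  complement in the component, so it is empty.\<close>

lemma connected_component_verts:
  assumes v: "v \<in> verts G"
  shows "Digraph_Component.connected (G \<restriction> component_verts G v)"
proof -
  let ?K = "component_verts G v"
  interpret K: wf_digraph "G \<restriction> ?K" by auto
  note K = saturated_component_verts[OF v]
  have lift: "saturated G S" if "saturated (G \<restriction> ?K) S" for S
    using that K by (auto simp: saturated_def)
  have "S = ?K" if S: "saturated (G \<restriction> ?K) S" "S \<noteq> {}" for S
  proof (cases "v \<in> S")
    case True
    then show ?thesis
      using component_verts_least[OF lift[OF S(1)]] S(1) by (auto simp: saturated_def)
  next
    case False
    then have "?K \<subseteq> ?K - S"
      using component_verts_least[OF lift[OF K.saturated_compl[OF S(1)]], of v] K(2) by simp
    then show ?thesis using S by (auto simp: saturated_def)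
  qed
  then show ?thesis using K(2) by (auto simp: K.connected_iff_saturated)
qed

text \<open>If \<open>u\<close> were outside the component of \<open>w\<close>, the complement of
  that component would be a saturated set around \<open>u\<close>, so the component of
  \<open>u\<close> would miss \<open>w\<close>.\<close>

lemma component_verts_eq:
  assumes u: "u \<in> verts G" and w: "w \<in> component_verts G u"
  shows "component_verts G w = component_verts G u"
proof -
  note U = saturated_component_verts[OF u]
  have w': "w \<in> verts G" using w U by auto
  note W = saturated_component_verts[OF w']
  have le: "component_verts G w \<subseteq> component_verts G u"
    by (rule component_verts_least[OF U(1) w])
  have "u \<in> component_verts G w"
  proof (rule ccontr)
    assume "u \<notin> component_verts G w"
    then have "component_verts G u \<subseteq> verts G - component_verts G w"
      using u by (intro component_verts_least[OF saturated_compl[OF W(1)]]) auto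
    then show False using w W(2) by auto
  qed
  then show ?thesis using le component_verts_least[OF W(1)] by blast
qed

text \<open>The trace of a saturated set on a subgraph is saturated there, so a connected subgraph
  that meets it lies inside it.\<close>

lemma connected_subgraph_verts_le:
  assumes X: "subgraph X G" "Digraph_Component.connected X" and v: "v \<in> verts X"
  shows "verts X \<subseteq> component_verts G v"
proof -
  interpret X: wf_digraph X using X by auto
  have v': "v \<in> verts G" using X v by auto
  note K = saturated_component_verts[OF v']
  have "saturated X (component_verts G v \<inter> verts X)"
    using K(1) X(1) by (auto simp: saturated_def subgraph_def compatible_def)
  then show ?thesis using X(2) v K(2) unfolding X.connected_iff_saturated by blast
qed

lemma components_of_eq: "components_of G = (\<lambda>v. G \<restriction> component_verts G v) ` verts G"
proof (intro equalityI subsetI)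
  fix X assume "X \<in> components_of G"
  then have X: "subgraph X G" "Digraph_Component.connected X"
    and max: "\<And>Y. subgraph X Y \<Longrightarrow> subgraph Y G \<Longrightarrow> Digraph_Component.connected Y \<Longrightarrow> Y = X"
    by (auto simp: components_of_def max_subgraph_def)
  interpret X: wf_digraph X using X by auto
  obtain v where v: "v \<in> verts X" using X(2) by (auto simp: X.connected_iff_saturated)
  have v': "v \<in> verts G" using X v by auto
  let ?Y = "G \<restriction> component_verts G v"
  have le: "verts X \<subseteq> component_verts G v" by (rule connected_subgraph_verts_le[OF X v])
  have "subgraph X ?Y"
    using X(1) le X.wellformed by (auto simp: subgraph_def compatible_def)
  moreover have "subgraph ?Y G"
    using saturated_component_verts(3)[OF v'] by (intro induced_imp_subgraph induced_induce)
  ultimately have "?Y = X"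
    by (rule max[OF _ _ connected_component_verts[OF v']])
  then show "X \<in> (\<lambda>v. G \<restriction> component_verts G v) ` verts G" using v' by blast
next
  fix X assume "X \<in> (\<lambda>v. G \<restriction> component_verts G v) ` verts G"
  then obtain v where v: "v \<in> verts G" and X: "X = G \<restriction> component_verts G v" by auto
  note K = saturated_component_verts[OF v]
  \<comment> \<open>A connected \<open>Y\<close> above \<open>X\<close> has no further vertices by
    \<open>connected_subgraph_verts_le\<close>, and no further arcs because \<open>X\<close> is
    induced.\<close>
  have "Y = X" if Y: "subgraph X Y" "subgraph Y G" "Digraph_Component.connected Y" for Y
  proof -
    interpret Y: wf_digraph Y using Y by auto
    have vY: "v \<in> verts Y" using Y(1) K(2) by (auto simp: X subgraph_def)
    have "verts Y \<subseteq> verts X" using connected_subgraph_verts_le[OF Y(2,3) vY] by (simp add: X)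
    then have "verts Y = verts X" "arcs Y = arcs X" "tail Y = tail X" "head Y = head X"
      using Y(1,2) Y.wellformed by (auto simp: X subgraph_def compatible_def)
    then show ?thesis by (simp add: pre_digraph.equality)
  qed
  moreover have "subgraph X G" unfolding X
    using K(3) by (intro induced_imp_subgraph induced_induce) auto
  ultimately show "X \<in> components_of G"
    using connected_component_verts[OF v] by (auto simp: X components_of_def max_subgraph_def)
qed

text \<open>Two components sharing a vertex \<open>w\<close> both equal the component of
  \<open>w\<close>, so injectivity of the indexing gives disjointness.\<close>

lemma components_partition:
  assumes "bij_betw X I (components_of G)"
  shows "\<And>i. i \<in> I \<Longrightarrow> saturated G (verts (X i)) \<and> X i = G \<restriction> verts (X i)"
    "disjoint_family_on (\<lambda>i. verts (X i)) I" "(\<Union>i\<in>I. verts (X i)) = verts G"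
proof -
  have ex: "\<exists>v\<in>verts G. X i = G \<restriction> component_verts G v" if "i \<in> I" for i
    using assms that by (auto simp: components_of_eq bij_betw_def)
  show "saturated G (verts (X i)) \<and> X i = G \<restriction> verts (X i)" if "i \<in> I" for i
    using ex[OF that] saturated_component_verts by auto
  show "disjoint_family_on (\<lambda>i. verts (X i)) I"
  proof (unfold disjoint_family_on_def, intro ballI impI)
    fix i j assume ij: "i \<in> I" "j \<in> I" "i \<noteq> j"
    obtain u v where uv: "u \<in> verts G" "X i = G \<restriction> component_verts G u"
        "v \<in> verts G" "X j = G \<restriction> component_verts G v"
      using ex ij by metis
    have "X i \<noteq> X j" using assms ij by (auto simp: bij_betw_def inj_on_def)
    moreover have "X i = X j" if "w \<in> verts (X i)" "w \<in> verts (X j)" for w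
      using that uv component_verts_eq[of u w] component_verts_eq[of v w] by simp
    ultimately show "verts (X i) \<inter> verts (X j) = {}" by blast
  qed
  show "(\<Union>i\<in>I. verts (X i)) = verts G"
  proof -
    have "(\<Union>i\<in>I. verts (X i)) = (\<Union>Y\<in>components_of G. verts Y)"
      by (simp add: bij_betw_imp_surj_on[OF assms, symmetric] image_image)
    then show ?thesis
      using saturated_component_verts(2,3) by (simp add: components_of_eq) blast
  qed
qed

text \<open>
  Shrinking both sides of a cut to connected pieces around a chosen arc \<open>e\<close> of it yields a bond
  through \<open>e\<close> all of whose arcs already belong to the cut.
\<close>

lemma bond_through_arc_of_cut:
  assumes conn: "Digraph_Component.connected G"
    and U: "U \<subseteq> verts G" and e: "e \<in> arcs G" "tail G e \<notin> U" "head G e \<in> U"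
  obtains C where "C \<noteq> {}" "C \<subset> verts G" "Digraph_Component.connected (G \<restriction> C)"
    "Digraph_Component.connected (G \<restriction> (verts G - C))" "tail G e \<notin> C" "head G e \<in> C"
    "\<And>e'. e' \<in> arcs G \<Longrightarrow> tail G e' \<notin> C \<Longrightarrow> head G e' \<in> C \<Longrightarrow> tail G e' \<notin> U \<and> head G e' \<in> U"
proof -
  let ?V = "verts G"
  interpret GU: wf_digraph "G \<restriction> U" by auto
  \<comment> \<open>The head side shrinks first, to the component of the head of \<open>e\<close>
    within \<open>U\<close>. No arc joins \<open>K\<close> to the rest of \<open>U\<close>.\<close>
  define K where "K = component_verts (G \<restriction> U) (head G e)"
  have K: "saturated (G \<restriction> U) K" "head G e \<in> K" "K \<subseteq> U"
    using GU.saturated_component_verts[of "head G e"] e by (auto simp: K_def)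
  have "Digraph_Component.connected ((G \<restriction> U) \<restriction> K)"
    unfolding K_def using e by (intro GU.connected_component_verts) auto
  moreover have "(G \<restriction> U) \<restriction> K = G \<restriction> K"
    using K(3) by (auto simp: induce_subgraph_def)
  ultimately have connK: "Digraph_Component.connected (G \<restriction> K)" by simp
  interpret GK: wf_digraph "G \<restriction> K" by auto
  interpret GW: wf_digraph "G \<restriction> (?V - K)" by auto
  have te: "tail G e \<in> ?V - K" using e K(3) by auto
  \<comment> \<open>The tail side is the component of the tail of \<open>e\<close> outside
    \<open>K\<close>; the bond will be given by the complement of \<open>B\<close>. Arcs leaving
    \<open>B\<close> can only go to \<open>K\<close>.\<close>
  define B where "B = component_verts (G \<restriction> (?V - K)) (tail G e)"
  have B: "saturated (G \<restriction> (?V - K)) B" "tail G e \<in> B" "B \<subseteq> ?V - K"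
    using GW.saturated_component_verts[of "tail G e"] te by (auto simp: B_def)
  have "Digraph_Component.connected ((G \<restriction> (?V - K)) \<restriction> B)"
    unfolding B_def using te by (intro GW.connected_component_verts) auto
  moreover have "(G \<restriction> (?V - K)) \<restriction> B = G \<restriction> B"
    using B(3) by (auto simp: induce_subgraph_def)
  ultimately have connB: "Digraph_Component.connected (G \<restriction> B)" by simp
  interpret GC: wf_digraph "G \<restriction> (?V - B)" by auto
  have he: "head G e \<in> ?V - B" using K B e by auto
  \<comment> \<open>Such a \<open>T\<close> misses the connected set \<open>K\<close>, and every arc
    between \<open>B\<close> and its complement ends in \<open>K\<close>. So \<open>T\<close> is
    saturated in all of \<open>G\<close>, which is connected.\<close>
  have empty: "T = {}" if T: "saturated (G \<restriction> (?V - B)) T" "head G e \<notin> T" for T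
  proof -
    have "saturated (G \<restriction> K) (T \<inter> K)"
      using T(1) B(3) by (auto simp: saturated_def)
    then have TK: "T \<inter> K = {}"
      using connK T(2) K(2) unfolding GK.connected_iff_saturated by auto
    have "tail G a \<in> T \<longleftrightarrow> head G a \<in> T" if a: "a \<in> arcs G" for a
    proof -
      have V: "tail G a \<in> ?V" "head G a \<in> ?V" using a by auto
      have "tail G a \<notin> B \<Longrightarrow> head G a \<notin> B \<Longrightarrow> ?thesis"
        using a V T(1) by (simp add: saturated_def)
      moreover have "tail G a \<notin> K \<Longrightarrow> head G a \<notin> K \<Longrightarrow> tail G a \<in> B \<longleftrightarrow> head G a \<in> B"
        using a V B(1) by (simp add: saturated_def)
      moreover have "T \<inter> B = {}" using T(1) by (auto simp: saturated_def)
      ultimately show ?thesis using TK B(3) by blast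
    qed
    then have "saturated G T" using T(1) by (auto simp: saturated_def)
    then show ?thesis using conn T(2) he unfolding connected_iff_saturated by auto
  qed
  have "S = ?V - B" if S: "saturated (G \<restriction> (?V - B)) S" "S \<noteq> {}" for S
  proof -
    have "?V - B - S = {}"
      using empty[OF S(1)] empty[OF GC.saturated_compl[OF S(1)]] S(2) by auto
    then show ?thesis using S(1) by (auto simp: saturated_def)
  qed
  then have connC: "Digraph_Component.connected (G \<restriction> (?V - B))"
    using he by (auto simp: GC.connected_iff_saturated)
  show thesis
  proof (rule that[of "?V - B"])
    fix a assume a: "a \<in> arcs G" "tail G a \<notin> ?V - B" "head G a \<in> ?V - B"
    then have tB: "tail G a \<in> B" by auto
    have hK: "head G a \<in> K" using a tB B(1,3) by (auto simp: saturated_def)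
    then have "tail G a \<notin> U" using a tB K(1,3) B(3) by (auto simp: saturated_def)
    then show "tail G a \<notin> U \<and> head G a \<in> U" using hK K(3) by auto
  next
    have "?V - (?V - B) = B" using B(3) by auto
    then show "Digraph_Component.connected (G \<restriction> (?V - (?V - B)))" using connB by simp
  qed (use he B te connC in auto)
qed

end

section \<open>The Voronoi cell as the projection of a cube\<close>

lemma coboundary_nth:
  "coboundary G f $ e = (if e \<in> arcs G then f (head G e) - f (tail G e) else 0)"
  by (simp add: coboundary_def)

lemma coboundary_in_cut_space: "coboundary G f \<in> cut_space G UNIV"
  by (simp add: cut_space_def cochains0_def)

lemma cut_space_Ints_le: "cut_space G \<int> \<subseteq> cut_space G UNIV"
  by (auto simp: cut_space_def cochains0_def)

lemma inner_cut_space: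
  fixes G :: "('v, 'e::finite) pre_digraph"
  assumes "z \<in> cut_space G UNIV"
  shows "x \<bullet> z = (\<Sum>e\<in>arcs G. x $ e * z $ e)"
  using edge_inner_cut[OF assms, of x] by (simp add: edge_inner_def)

lemma inner_cut_projection:
  assumes "z \<in> cut_space G UNIV"
  shows "cut_projection G x \<bullet> z = x \<bullet> z"
  using cut_projection_orth[OF assms, of x] by (simp add: edge_inner_cut[OF assms] inner_diff_left)

text \<open>Squaring and expanding the norms gives this; the factor \<open>1/2\<close> in
  \<open>edge_inner\<close> cancels, so the ordinary inner product can be used from here on.\<close>

lemma voronoi_cell_iff:
  "y \<in> voronoi_cell G \<longleftrightarrow>
     y \<in> cut_space G UNIV \<and> (\<forall>\<alpha>\<in>cut_space G \<int>. 2 * (y \<bullet> \<alpha>) \<le> \<alpha> \<bullet> \<alpha>)"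
proof -
  have "edge_norm G y \<le> edge_norm G (y - \<alpha>) \<longleftrightarrow> 2 * (y \<bullet> \<alpha>) \<le> \<alpha> \<bullet> \<alpha>"
    if "y \<in> cut_space G UNIV" "\<alpha> \<in> cut_space G \<int>" for \<alpha>
  proof -
    have "y - \<alpha> \<in> cut_space G UNIV"
      using that cut_space_Ints_le by (auto intro: subspace_diff[OF subspace_cut_space])
    then show ?thesis
      using that(1)
      by (simp add: edge_norm_def edge_inner_cut inner_diff_left inner_diff_right inner_commute)
  qed
  then show ?thesis by (auto simp: voronoi_cell_def)
qed

section \<open>Convexity and compactness of the cube faces\<close>

lemma convex_cube_face: "convex (cube_face G arev D)"
proof (rule convexI)
  fix x y and u v :: real
  assume x: "x \<in> cube_face G arev D" and y: "y \<in> cube_face G arev D"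
    and uv: "0 \<le> u" "0 \<le> v" "u + v = 1"
  have "\<bar>u * x $ e + v * y $ e\<bar> \<le> 1/2" if "e \<in> arcs G" for e
  proof -
    have "\<bar>x $ e\<bar> \<le> 1/2" "\<bar>y $ e\<bar> \<le> 1/2" using that x y by (auto simp: cube_face_def)
    then have "x $ e \<in> {- (1/2)..1/2}" "y $ e \<in> {- (1/2)..1/2}" by auto
    then have "u *\<^sub>R x $ e + v *\<^sub>R y $ e \<in> {- (1/2)..1/2}"
      by (intro convexD[OF convex_real_interval(5)] uv)
    then show ?thesis unfolding atLeastAtMost_iff real_scaleR_def by linarith
  qed
  moreover have "u * x $ e + v * y $ e = 1/2" if "e \<in> D" for e
  proof -
    have half: "x $ e = 1/2" "y $ e = 1/2" using that x y by (auto simp: cube_face_def)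
    show ?thesis unfolding half using uv(3) by simp
  qed
  ultimately show "u *\<^sub>R x + v *\<^sub>R y \<in> cube_face G arev D"
    using x y by (auto simp: cube_face_def cochains1_def)
qed

lemma compact_cube_face: "compact (cube_face G arev D)"
proof -
  have "cube_face G arev D \<subseteq> cbox (\<chi> _. - 1/2) (\<chi> _. 1/2)"
  proof
    fix x assume x: "x \<in> cube_face G arev D"
    have "\<bar>x $ e\<bar> \<le> 1/2" for e
      using x by (cases "e \<in> arcs G") (auto simp: cube_face_def cochains1_def)
    then show "x \<in> cbox (\<chi> _. - 1/2) (\<chi> _. 1/2)"
      unfolding mem_box_cart by (metis abs_le_iff minus_divide_left minus_le_iff vec_lambda_beta)
  qed
  then have "bounded (cube_face G arev D)"
    using bounded_cbox bounded_subset by blast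
  moreover have "closed (cube_face G arev D)"
    unfolding cube_face_def cochains1_def Ball_def mem_Collect_eq
    by (intro closed_Collect_all closed_Collect_conj closed_Collect_imp closed_Collect_eq
        closed_Collect_le open_Collect_const continuous_intros) simp
  ultimately show ?thesis by (simp add: compact_eq_bounded_closed)
qed

text \<open>
  Layer-cake: \<open>f\<close> is a nonnegative combination of indicators of its upper level sets up to a
  constant, and the total variation of \<open>f\<close> along each arc is additive in this decomposition.
\<close>

lemma inner_coboundary_le:
  fixes G :: "('v, 'e::finite) pre_digraph"
  assumes "wf_digraph G" and fin: "finite (verts G)"
    and cuts: "\<And>C. C \<subseteq> verts G \<Longrightarrow>
      y \<bullet> coboundary G (indicator C) \<le> (\<Sum>e\<in>arcs G. \<bar>coboundary G (indicator C) $ e\<bar>)"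
  shows "y \<bullet> coboundary G f \<le> (\<Sum>e\<in>arcs G. \<bar>coboundary G f $ e\<bar>)"
proof (induction "card (f ` verts G)" arbitrary: f rule: less_induct)
  case less
  interpret wf_digraph G by fact
  show ?case
  proof (cases "\<exists>c. \<forall>v\<in>verts G. f v = c")
    case True
    then have "coboundary G f = 0" by (auto simp: vec_eq_iff coboundary_nth)
    then show ?thesis by simp
  next
    case False
    \<comment> \<open>The induction is on the number of values of \<open>f\<close>. Truncating
      \<open>f\<close> at its second largest value \<open>m'\<close> removes one value and splits
      off a positive multiple of the indicator of the top level set \<open>C\<close>.\<close>
    define m where "m = Max (f ` verts G)"
    define m' where "m' = Max (f ` verts G - {m})"
    define g where "g = (\<lambda>v. min (f v) m')"
    define C where "C = {v \<in> verts G. f v = m}"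
    have ne: "verts G \<noteq> {}" using False by auto
    then have m: "m \<in> f ` verts G" "\<And>v. v \<in> verts G \<Longrightarrow> f v \<le> m"
      unfolding m_def using fin by (auto intro!: Max_in)
    have ne': "f ` verts G - {m} \<noteq> {}" using False by blast
    then have "m' \<in> f ` verts G - {m}" unfolding m'_def using fin by (intro Max_in) auto
    moreover have below: "f v \<le> m'" if "v \<in> verts G" "f v \<noteq> m" for v
      unfolding m'_def using fin that by (intro Max_ge) auto
    ultimately have m': "m' \<in> f ` verts G" "m' < m" using m by force+
    have g: "g v = (if v \<in> C then m' else f v)" if "v \<in> verts G" for v
      using that below m' by (auto simp: g_def C_def)
    have "g ` verts G \<subseteq> f ` verts G" using g m'(1) by auto
    moreover have "m \<notin> g ` verts G" using m'(2) by (auto simp: g_def min_def)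
    ultimately have "card (g ` verts G) < card (f ` verts G)"
      using fin m(1) by (intro psubset_card_mono) auto
    then have IH: "y \<bullet> coboundary G g \<le> (\<Sum>e\<in>arcs G. \<bar>coboundary G g $ e\<bar>)" by (rule less)
    have split: "coboundary G f = coboundary G g + (m - m') *\<^sub>R coboundary G (indicator C)"
      by (auto simp: vec_eq_iff coboundary_nth g indicator_def C_def)
    \<comment> \<open>Absolute values add because the two summands never have opposite signs:
      outside \<open>C\<close> the function \<open>f\<close> is at most \<open>m'\<close>.\<close>
    have var: "\<bar>coboundary G f $ e\<bar> =
        \<bar>coboundary G g $ e\<bar> + (m - m') * \<bar>coboundary G (indicator C) $ e\<bar>"
      if e: "e \<in> arcs G" for e
      using e m'(2) below[of "tail G e"] below[of "head G e"]
      by (auto simp: coboundary_nth g indicator_def C_def)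
    have "y \<bullet> coboundary G f = y \<bullet> coboundary G g + (m - m') * (y \<bullet> coboundary G (indicator C))"
      by (simp add: split inner_add_right)
    also have "\<dots> \<le> (\<Sum>e\<in>arcs G. \<bar>coboundary G g $ e\<bar>) +
        (m - m') * (\<Sum>e\<in>arcs G. \<bar>coboundary G (indicator C) $ e\<bar>)"
      using IH m'(2) cuts[of C] by (intro add_mono mult_left_mono) (auto simp: C_def)
    also have "\<dots> = (\<Sum>e\<in>arcs G. \<bar>coboundary G f $ e\<bar>)"
      by (simp add: var sum.distrib sum_distrib_left)
    finally show ?thesis .
  qed
qed

lemma abs_le_square_Ints:
  fixes a :: real
  assumes "a \<in> \<int>"
  shows "\<bar>a\<bar> \<le> a * a"
proof -
  obtain k where a: "a = of_int k" using assms by (elim Ints_cases)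
  have "\<bar>k\<bar> \<le> k * k"
    using mult_left_mono[of 1 "\<bar>k\<bar>" "\<bar>k\<bar>"] by (cases "k = 0") (auto simp: abs_mult_self_eq)
  then show ?thesis unfolding a by (metis of_int_abs of_int_le_iff of_int_mult)
qed

text \<open>
  Weaker than \<^locale>\<open>bidirected_digraph\<close>, in that \<open>arev\<close> is unconstrained outside the arcs: this
  makes it hereditary to arc-symmetric subgraphs with the same \<open>arev\<close>.
\<close>

locale reversible_digraph = fin_digraph G for G :: "('v, 'e::finite) pre_digraph" +
  fixes arev :: "'e \<Rightarrow> 'e"
  assumes arev_arcs: "e \<in> arcs G \<Longrightarrow> arev e \<in> arcs G"
    and tail_rev: "e \<in> arcs G \<Longrightarrow> tail G (arev e) = head G e"
    and head_rev: "e \<in> arcs G \<Longrightarrow> head G (arev e) = tail G e"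
begin

text \<open>Pairing with a lattice vector does not see the projection, so the Voronoi inequality can
  be checked on \<open>x\<close> arc by arc.\<close>

lemma projection_cube_face_le: "cut_projection G ` cube_face G arev D \<subseteq> voronoi_cell G"
proof
  fix y assume "y \<in> cut_projection G ` cube_face G arev D"
  then obtain x where x: "x \<in> cube_face G arev D" and y: "y = cut_projection G x" by auto
  have "2 * (y \<bullet> \<alpha>) \<le> \<alpha> \<bullet> \<alpha>" if \<alpha>: "\<alpha> \<in> cut_space G \<int>" for \<alpha>
  proof -
    have F: "\<alpha> \<in> cut_space G UNIV" using \<alpha> cut_space_Ints_le by auto
    have "2 * (y \<bullet> \<alpha>) = (\<Sum>e\<in>arcs G. (2 * x $ e) * \<alpha> $ e)"
      unfolding y inner_cut_projection[OF F]
      by (simp add: inner_cut_space[OF F] sum_distrib_left mult.assoc)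
    also have "\<dots> \<le> (\<Sum>e\<in>arcs G. \<alpha> $ e * \<alpha> $ e)"
    proof (rule sum_mono)
      fix e assume e: "e \<in> arcs G"
      have "(2 * x $ e) * \<alpha> $ e \<le> \<bar>2 * x $ e\<bar> * \<bar>\<alpha> $ e\<bar>"
        by (metis abs_ge_self abs_mult)
      also have "\<dots> \<le> 1 * \<bar>\<alpha> $ e\<bar>"
        using x e by (intro mult_right_mono) (auto simp: cube_face_def abs_mult)
      also have "\<dots> \<le> \<alpha> $ e * \<alpha> $ e"
        using \<alpha> e abs_le_square_Ints[of "\<alpha> $ e"]
        by (auto simp: cut_space_def cochains0_def coboundary_nth Pi_iff)
      finally show "(2 * x $ e) * \<alpha> $ e \<le> \<alpha> $ e * \<alpha> $ e" .
    qed
    finally show ?thesis by (simp add: inner_cut_space[OF F])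
  qed
  then show "y \<in> voronoi_cell G"
    using cut_projection_in by (simp add: voronoi_cell_iff y)
qed

lemma projection_cube: "cut_projection G ` cube_face G arev {} = voronoi_cell G"
proof (intro equalityI projection_cube_face_le subsetI)
  fix y assume y: "y \<in> voronoi_cell G"
  let ?P = "cut_projection G ` cube_face G arev {}"
  have yF: "y \<in> cut_space G UNIV" using y by (simp add: voronoi_cell_iff)
  show "y \<in> ?P"
  proof (rule ccontr)
    assume "y \<notin> ?P"
    moreover have "convex ?P"
      by (rule convex_linear_image[OF linear_cut_projection convex_cube_face])
    moreover have "closed ?P"
      by (intro compact_imp_closed compact_continuous_image compact_cube_face
          linear_continuous_on linear_conv_bounded_linear[THEN iffD1] linear_cut_projection)
    ultimately obtain a b where ab: "a \<bullet> y < b" "\<And>x. x \<in> ?P \<Longrightarrow> b < a \<bullet> x"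
      using separating_hyperplane_closed_point[of ?P y] by auto
    \<comment> \<open>Points of the cut space pair with the separating normal only through its
      projection. The sign change makes \<open>y\<close> exceed the projected cube in direction
      \<open>z\<close>.\<close>
    define z where "z = cut_projection G (- a)"
    have z: "x \<bullet> z = - (a \<bullet> x)" if "x \<in> cut_space G UNIV" for x
      using inner_cut_projection[OF that, of "- a"] by (simp add: z_def inner_commute)
    have zF: "z \<in> cut_space G UNIV" by (simp add: z_def cut_projection_in)
    then obtain f where f: "z = coboundary G f" by (auto simp: cut_space_def)
    \<comment> \<open>The entries of a cut vector are \<open>-1\<close>, \<open>0\<close> or
      \<open>1\<close>, so its squared norm is its sum of absolute values: the Voronoi inequality is
      the hypothesis of \<open>inner_coboundary_le\<close> for \<open>2 *\<^sub>R y\<close>.\<close>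
    have "(2 *\<^sub>R y) \<bullet> coboundary G (indicator C) \<le> (\<Sum>e\<in>arcs G. \<bar>coboundary G (indicator C) $ e\<bar>)"
      for C
    proof -
      let ?b = "coboundary G (indicator C)"
      have "?b \<in> cut_space G \<int>" by (auto simp: cut_space_def cochains0_def indicator_def)
      then have "(2 *\<^sub>R y) \<bullet> ?b \<le> ?b \<bullet> ?b" using y by (simp add: voronoi_cell_iff)
      also have "\<dots> = (\<Sum>e\<in>arcs G. \<bar>?b $ e\<bar>)"
        unfolding inner_cut_space[OF coboundary_in_cut_space]
        by (intro sum.cong) (auto simp: coboundary_nth indicator_def)
      finally show ?thesis .
    qed
    then have "(2 *\<^sub>R y) \<bullet> z \<le> (\<Sum>e\<in>arcs G. \<bar>z $ e\<bar>)"
      unfolding f by (rule inner_coboundary_le[OF wf_digraph_axioms finite_verts])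
    \<comment> \<open>The sign vector is a point of the cube at which the pairing with
      \<open>z\<close> is largest. Its value attains the bound just shown for \<open>y\<close>,
      against the separation.\<close>
    moreover define x :: "real ^ 'e" where "x = (\<chi> e. sgn (z $ e) / 2)"
    have "x \<in> cube_face G arev {}"
      by (auto simp: cube_face_def cochains1_def x_def f coboundary_nth arev_arcs tail_rev head_rev
          sgn_if)
    then have "b < a \<bullet> cut_projection G x" by (intro ab(2)) auto
    then have "cut_projection G x \<bullet> z < - b" by (simp add: z cut_projection_in)
    then have "2 * (x \<bullet> z) < - 2 * b" by (simp add: inner_cut_projection[OF zF])
    moreover have "2 * (x \<bullet> z) = (\<Sum>e\<in>arcs G. \<bar>z $ e\<bar>)"
      unfolding inner_cut_space[OF zF] sum_distrib_left
      by (intro sum.cong) (auto simp: x_def abs_sgn mult.commute)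
    ultimately show False using ab(1) z[OF yF] by simp
  qed
qed

lemma projection_cube_face:
  assumes conn: "Digraph_Component.connected G" and D: "coherent_acyclic G D"
  shows "cut_projection G ` cube_face G arev D = voronoi_face G D"
proof (intro equalityI subsetI)
  fix y assume "y \<in> cut_projection G ` cube_face G arev D"
  then obtain x where x: "x \<in> cube_face G arev D" and y: "y = cut_projection G x" by auto
  have "2 * edge_inner G y \<beta> = (edge_norm G \<beta>)\<^sup>2"
    if \<beta>: "\<beta> \<in> bond_elements G" "positive_support G \<beta> \<subseteq> D" for \<beta>
  proof -
    obtain C where C: "\<beta> = coboundary G (indicator C)" using \<beta>(1) by (auto simp: bond_elements_def)
    have F: "\<beta> \<in> cut_space G UNIV" by (simp add: C coboundary_in_cut_space)
    have "2 * (x \<bullet> \<beta>) = (\<Sum>e\<in>arcs G. 2 * (x $ e * \<beta> $ e))"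
      by (simp add: inner_cut_space[OF F] sum_distrib_left)
    also have "\<dots> = (\<Sum>e\<in>arcs G. \<beta> $ e * \<beta> $ e)"
    proof (rule sum.cong)
      fix e assume e: "e \<in> arcs G"
      have half: "x $ a = 1/2" if "a \<in> arcs G" "\<beta> $ a > 0" for a
        using that \<beta>(2) x by (auto simp: positive_support_def cube_face_def)
      have "\<beta> $ arev e = - \<beta> $ e" "x $ arev e = - x $ e"
        using e x by (auto simp: C coboundary_nth arev_arcs tail_rev head_rev cube_face_def
            cochains1_def)
      moreover have "\<beta> $ e \<in> {-1, 0, 1}" by (auto simp: C coboundary_nth indicator_def)
      \<comment> \<open>Where \<open>\<beta>\<close> is negative, the reverse arc is in the positive
        support, hence in \<open>D\<close>, and antisymmetry gives
        \<open>x $ e = -1/2\<close>.\<close>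
      ultimately show "2 * (x $ e * \<beta> $ e) = \<beta> $ e * \<beta> $ e"
        using half[OF e] half[OF arev_arcs[OF e]] by auto
    qed simp
    finally have "2 * (x \<bullet> \<beta>) = \<beta> \<bullet> \<beta>" by (simp add: inner_cut_space[OF F])
    then show ?thesis
      by (simp add: y edge_norm_def edge_inner_cut[OF F] inner_cut_projection[OF F])
  qed
  moreover have "y \<in> voronoi_cell G"
    using projection_cube_face_le x y by blast
  ultimately show "y \<in> voronoi_face G D"
    using cut_projection_in by (auto simp: voronoi_face_def y)
next
  fix y assume y: "y \<in> voronoi_face G D"
  then have "y \<in> voronoi_cell G" by (simp add: voronoi_face_def)
  then obtain x where x: "x \<in> cube_face G arev {}" and yx: "y = cut_projection G x"
    using projection_cube by auto
  \<comment> \<open>Any preimage \<open>x\<close> in the full cube will do: the face equations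
    already force it into the face of the cube.\<close>
  have half: "x $ e = 1/2" if e: "e \<in> D" for e
  proof -
    obtain s :: nat and P where P: "disjoint_family_on P {1..s}" "(\<Union>i\<in>{1..s}. P i) = verts G"
      and Deq: "D = {e \<in> arcs G. \<exists>i\<in>{1..s}. \<exists>j\<in>{1..s}. i < j \<and> tail G e \<in> P i \<and> head G e \<in> P j}"
      using D unfolding coherent_acyclic_def by (elim exE conjE) (rule that)
    obtain i j where ij: "i \<in> {1..s}" "j \<in> {1..s}" "i < j" "tail G e \<in> P i" "head G e \<in> P j"
      and eG: "e \<in> arcs G" using e Deq by auto
    \<comment> \<open>All parts after that of the tail of \<open>e\<close>. Arcs entering
      \<open>U\<close> go from an index at most \<open>i\<close> to a larger one, so they lie in
      \<open>D\<close>, and so do those of the bond found inside this cut.\<close>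
    define U where "U = (\<Union>k\<in>{i<..s}. P k)"
    have "U \<subseteq> verts G" using P(2) ij(1) by (force simp: U_def)
    moreover have "tail G e \<notin> U"
    proof
      assume "tail G e \<in> U"
      then obtain k where k: "k \<in> {i<..s}" "tail G e \<in> P k" by (auto simp: U_def)
      have "P i \<inter> P k = {}"
        using P(1) ij(1) k(1) by (auto simp: disjoint_family_on_def)
      then show False using ij(4) k(2) by blast
    qed
    moreover have "head G e \<in> U" using ij by (auto simp: U_def)
    ultimately obtain C where C: "C \<noteq> {}" "C \<subset> verts G" "Digraph_Component.connected (G \<restriction> C)"
      "Digraph_Component.connected (G \<restriction> (verts G - C))" "tail G e \<notin> C" "head G e \<in> C"
      and CU: "\<And>a. a \<in> arcs G \<Longrightarrow> tail G a \<notin> C \<Longrightarrow> head G a \<in> C \<Longrightarrow> tail G a \<notin> U \<and> head G a \<in> U"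
      using bond_through_arc_of_cut[OF conn _ eG] by metis
    define \<beta> where "\<beta> = coboundary G (indicator C)"
    have F: "\<beta> \<in> cut_space G UNIV" by (simp add: \<beta>_def coboundary_in_cut_space)
    have \<beta>: "\<beta> \<in> bond_elements G" unfolding bond_elements_def \<beta>_def using C(1-4) by blast
    have "positive_support G \<beta> \<subseteq> D"
    proof
      fix a assume "a \<in> positive_support G \<beta>"
      then have a: "a \<in> arcs G" "tail G a \<notin> C" "head G a \<in> C"
        by (auto simp: positive_support_def \<beta>_def coboundary_nth indicator_def split: if_splits)
      then have aU: "tail G a \<notin> U" "head G a \<in> U" using CU by auto
      obtain l where l: "l \<in> {i<..s}" "head G a \<in> P l" using aU by (auto simp: U_def)
      have "tail G a \<in> (\<Union>i\<in>{1..s}. P i)" unfolding P(2) using a by auto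
      then obtain k where k: "k \<in> {1..s}" "tail G a \<in> P k" by auto
      then have "k \<le> i" using aU by (force simp: U_def)
      then have "l \<in> {1..s}" "k < l" using l(1) k(1) by auto
      then show "a \<in> D" unfolding Deq using a(1) k l(2) by blast
    qed
    then have "2 * edge_inner G y \<beta> = (edge_norm G \<beta>)\<^sup>2"
      using y \<beta> by (auto simp: voronoi_face_def)
    then have "2 * (x \<bullet> \<beta>) = \<beta> \<bullet> \<beta>"
      by (simp add: yx edge_norm_def edge_inner_cut[OF F] inner_cut_projection[OF F])
    then have sum0: "(\<Sum>e\<in>arcs G. \<beta> $ e * \<beta> $ e - 2 * (x $ e * \<beta> $ e)) = 0"
      by (simp add: inner_cut_space[OF F] sum_subtractf sum_distrib_left)
    \<comment> \<open>The terms of the vanishing sum are nonnegative, so each is zero; at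
      \<open>e\<close>, where \<open>\<beta>\<close> is \<open>1\<close>, this reads
      \<open>x $ e = 1/2\<close>.\<close>
    have "0 \<le> \<beta> $ a * \<beta> $ a - 2 * (x $ a * \<beta> $ a)" if a: "a \<in> arcs G" for a
    proof -
      have "\<beta> $ a \<in> {-1, 0, 1}" by (auto simp: \<beta>_def coboundary_nth indicator_def)
      moreover have "\<bar>x $ a\<bar> \<le> 1/2" using x a by (auto simp: cube_face_def)
      ultimately show ?thesis by auto
    qed
    then have "\<beta> $ e * \<beta> $ e - 2 * (x $ e * \<beta> $ e) = 0"
      using sum0 eG by (simp add: sum_nonneg_eq_0_iff)
    moreover have "\<beta> $ e = 1" using C eG by (simp add: \<beta>_def coboundary_nth)
    ultimately show ?thesis by simp
  qed
  then have "x \<in> cube_face G arev D" using x by (auto simp: cube_face_def)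
  then show "y \<in> cut_projection G ` cube_face G arev D" using yx by blast
qed

end

section \<open>Decomposition along components\<close>

text \<open>No arc joins different parts, so the coboundary splits into pieces with disjoint
  supports. These are orthogonal, and the Voronoi inequalities can be tested piece by piece.\<close>

lemma voronoi_cell_eq_sum:
  fixes G :: "('v, 'e::finite) pre_digraph"
  assumes "wf_digraph G" and fin: "finite I"
    and P: "\<And>i. i \<in> I \<Longrightarrow> saturated G (P i)" "disjoint_family_on P I" "(\<Union>i\<in>I. P i) = verts G"
  shows "voronoi_cell G = (\<Sum>i\<in>I. voronoi_cell (G \<restriction> P i))"
proof -
  interpret wf_digraph G by fact
  let ?d = "\<lambda>i. coboundary (G \<restriction> P i)"
  have head: "head G e \<in> P i \<longleftrightarrow> tail G e \<in> P i" if "i \<in> I" "e \<in> arcs G" for i e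
    using P(1) that by (auto simp: saturated_def)
  have nth: "?d i f $ e = (if e \<in> arcs G \<and> tail G e \<in> P i then f (head G e) - f (tail G e) else 0)"
    if "i \<in> I" for i f e
    using head[OF that] by (auto simp: coboundary_nth)
  have sum_d: "(\<Sum>i\<in>I. ?d i f) = coboundary G f" for f
  proof (rule vec_eq_iff[THEN iffD2, rule_format])
    fix e
    show "(\<Sum>i\<in>I. ?d i f) $ e = coboundary G f $ e"
    proof (cases "e \<in> arcs G")
      case True
      then have "tail G e \<in> (\<Union>i\<in>I. P i)" unfolding P(3) by simp
      then obtain i0 where i0: "i0 \<in> I" "tail G e \<in> P i0" by auto
      have "tail G e \<in> P i \<longleftrightarrow> i = i0" if "i \<in> I" for i
        using P(2) i0 that by (auto simp: disjoint_family_on_def)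
      then have "(\<Sum>i\<in>I. ?d i f) $ e = (\<Sum>i\<in>I. if i = i0 then f (head G e) - f (tail G e) else 0)"
        unfolding sum_component using True by (intro sum.cong) (auto simp: nth)
      then show ?thesis using True i0 fin by (simp add: coboundary_nth)
    qed (simp add: sum_component nth coboundary_nth)
  qed
  have orth: "?d i f \<bullet> coboundary G g = ?d i f \<bullet> ?d i g" if "i \<in> I" for i f g
    unfolding inner_vec_def by (intro sum.cong) (auto simp: nth that coboundary_nth)
  show ?thesis
  proof (intro equalityI subsetI)
    fix y assume y: "y \<in> voronoi_cell G"
    then obtain f where f: "y = coboundary G f" by (auto simp: voronoi_cell_iff cut_space_def)
    have "?d i f \<in> voronoi_cell (G \<restriction> P i)" if i: "i \<in> I" for i
      unfolding voronoi_cell_iff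
    proof (intro conjI ballI)
      fix \<alpha> assume "\<alpha> \<in> cut_space (G \<restriction> P i) \<int>"
      then obtain g where g: "\<alpha> = ?d i g" "g \<in> P i \<rightarrow> \<int>"
        by (auto simp: cut_space_def cochains0_def)
      \<comment> \<open>Extension by zero keeps integrality and, as no arc leaves
        \<open>P i\<close>, does not change the coboundary.\<close>
      let ?g = "\<lambda>v. if v \<in> P i then g v else 0"
      have "?d i g = coboundary G ?g"
        using head[OF i] by (auto simp: vec_eq_iff nth[OF i] coboundary_nth)
      moreover have "coboundary G ?g \<in> cut_space G \<int>"
        unfolding cut_space_def cochains0_def using g(2) by (intro imageI) auto
      ultimately have "2 * (y \<bullet> \<alpha>) \<le> \<alpha> \<bullet> \<alpha>" using y g(1) by (simp add: voronoi_cell_iff)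
      moreover have "y \<bullet> \<alpha> = ?d i f \<bullet> \<alpha>"
        using orth[OF i, of g f] by (simp add: f g(1) inner_commute)
      ultimately show "2 * (?d i f \<bullet> \<alpha>) \<le> \<alpha> \<bullet> \<alpha>" by simp
    qed (rule coboundary_in_cut_space)
    then show "y \<in> (\<Sum>i\<in>I. voronoi_cell (G \<restriction> P i))"
      unfolding set_sum_alt[OF fin] f sum_d[symmetric] by blast
  next
    fix y assume "y \<in> (\<Sum>i\<in>I. voronoi_cell (G \<restriction> P i))"
    then obtain s where s: "y = sum s I" "\<And>i. i \<in> I \<Longrightarrow> s i \<in> voronoi_cell (G \<restriction> P i)"
      unfolding set_sum_alt[OF fin] by blast
    have "\<forall>i\<in>I. \<exists>f. s i = ?d i f"
      using s(2) by (auto simp: voronoi_cell_iff cut_space_def)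
    then obtain f where f: "\<And>i. i \<in> I \<Longrightarrow> s i = ?d i (f i)" by metis
    \<comment> \<open>Each summand comes with its own potential \<open>f i\<close>; selecting the
      part that contains \<open>v\<close> glues them into one potential on \<open>G\<close>.\<close>
    define idx where "idx v = (SOME i. i \<in> I \<and> v \<in> P i)" for v
    have idx: "idx v = i" if "i \<in> I" "v \<in> P i" for v i
      unfolding idx_def using P(2) that by (intro some_equality) (auto simp: disjoint_family_on_def)
    let ?F = "\<lambda>v. f (idx v) v"
    have "s i = ?d i ?F" if i: "i \<in> I" for i
      using head[OF i] idx[OF i] by (auto simp: vec_eq_iff nth[OF i] f[OF i])
    then have "y = coboundary G ?F" unfolding s(1) by (simp add: sum_d[symmetric])
    then have yF: "y \<in> cut_space G UNIV" by (simp add: coboundary_in_cut_space)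
    have "2 * (y \<bullet> \<alpha>) \<le> \<alpha> \<bullet> \<alpha>" if \<alpha>: "\<alpha> \<in> cut_space G \<int>" for \<alpha>
    proof -
      obtain g where g: "\<alpha> = coboundary G g" "g \<in> verts G \<rightarrow> \<int>"
        using \<alpha> by (auto simp: cut_space_def cochains0_def)
      have "2 * (y \<bullet> \<alpha>) = (\<Sum>i\<in>I. 2 * (s i \<bullet> ?d i g))"
        by (simp add: s(1) g(1) inner_sum_left sum_distrib_left f orth)
      also have "\<dots> \<le> (\<Sum>i\<in>I. ?d i g \<bullet> ?d i g)"
      proof (rule sum_mono)
        fix i assume i: "i \<in> I"
        then have "?d i g \<in> cut_space (G \<restriction> P i) \<int>"
          using g(2) P(1)[OF i] by (auto simp: cut_space_def cochains0_def saturated_def)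
        then show "2 * (s i \<bullet> ?d i g) \<le> ?d i g \<bullet> ?d i g"
          using s(2)[OF i] by (simp add: voronoi_cell_iff)
      qed
      also have "\<dots> = (\<Sum>i\<in>I. ?d i g \<bullet> \<alpha>)" by (simp add: g(1) orth)
      also have "\<dots> = \<alpha> \<bullet> \<alpha>" by (simp add: inner_sum_left[symmetric] sum_d g(1))
      finally show ?thesis .
    qed
    then show "y \<in> voronoi_cell G" using yF by (simp add: voronoi_cell_iff)
  qed
qed

section \<open>Cut spaces before and after deleting the edges of \<open>D\<close>\<close>

lemma inner_coboundary_remove_oriented:
  fixes G :: "('v, 'e::finite) pre_digraph"
  assumes "\<And>e. e \<notin> arcs (remove_oriented G arev D) \<Longrightarrow> x $ e = 0"
  shows "x \<bullet> coboundary G f = x \<bullet> coboundary (remove_oriented G arev D) f"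
  unfolding inner_vec_def using assms
  by (intro sum.cong) (auto simp: coboundary_nth remove_oriented_def)

lemma cut_space_eq_0_outside: "z \<in> cut_space G A \<Longrightarrow> e \<notin> arcs G \<Longrightarrow> z $ e = 0"
  by (auto simp: cut_space_def coboundary_nth)

text \<open>The test vectors for the projection of \<open>G\<close> are coboundaries. Against
  vectors supported on \<open>H\<close> they act as coboundaries of \<open>H\<close>, and these
  pairings survive projection to the cut space of \<open>H\<close>.\<close>

lemma cut_projection_remove_oriented:
  fixes G :: "('v, 'e::finite) pre_digraph" and arev :: "'e \<Rightarrow> 'e" and D :: "'e set"
  defines "H \<equiv> remove_oriented G arev D"
  assumes x: "\<And>e. e \<notin> arcs H \<Longrightarrow> x $ e = 0"
  shows "cut_projection G (cut_projection H x) = cut_projection G x"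
proof (rule cut_projection_unique[OF cut_projection_in])
  fix z assume z: "z \<in> cut_space G UNIV"
  then obtain f where f: "z = coboundary G f" by (auto simp: cut_space_def)
  have "cut_projection H x \<bullet> z = cut_projection H x \<bullet> coboundary H f"
    unfolding f H_def
    by (intro inner_coboundary_remove_oriented cut_space_eq_0_outside[OF cut_projection_in])
  also have "\<dots> = x \<bullet> coboundary H f"
    by (rule inner_cut_projection[OF coboundary_in_cut_space])
  also have "\<dots> = x \<bullet> z"
    unfolding f H_def using x
    by (intro inner_coboundary_remove_oriented[symmetric]) (simp add: H_def)
  finally show "edge_inner G (cut_projection H x - cut_projection G x) z = 0"
    by (simp add: edge_inner_cut[OF z] inner_diff_left inner_cut_projection[OF z])
qed

text \<open>If \<open>w\<close>, the coboundary of \<open>f\<close> in \<open>H\<close>, projects to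
  zero, it is orthogonal to the coboundary of \<open>f\<close> in \<open>G\<close>. That pairing
  equals \<open>w \<bullet> w\<close>.\<close>

lemma inj_on_cut_projection_remove_oriented:
  fixes G :: "('v, 'e::finite) pre_digraph"
  shows "inj_on (cut_projection G) (cut_space (remove_oriented G arev D) UNIV)"
proof -
  let ?H = "remove_oriented G arev D"
  have "w = 0" if w: "w \<in> cut_space ?H UNIV" "cut_projection G w = 0" for w
  proof -
    obtain f where f: "w = coboundary ?H f" using w(1) by (auto simp: cut_space_def)
    have "w \<bullet> w = w \<bullet> coboundary G f"
      unfolding f by (intro inner_coboundary_remove_oriented[symmetric]) (simp add: coboundary_nth)
    also have "\<dots> = 0"
      using inner_cut_projection[OF coboundary_in_cut_space, of G w f] w(2) by simp
    finally show ?thesis by simp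
  qed
  then show ?thesis
    using linear_inj_on_iff_eq_0[OF linear_cut_projection subspace_cut_space] by blast
qed

text \<open>The index of the part strictly increases along arcs of \<open>D\<close>, and
  disjointness makes it unique. Hence the \<open>1\<close> and \<open>-1\<close> cases of
  \<open>orientation_char\<close> never conflict.\<close>

lemma coherent_acyclic_asym:
  assumes "bidirected_digraph G arev" and D: "coherent_acyclic G D" and e: "e \<in> D"
  shows "e \<in> arcs G" "arev e \<notin> D"
proof -
  interpret bidirected_digraph G arev by fact
  obtain s :: nat and P where P: "disjoint_family_on P {1..s}"
    and Deq: "D = {e \<in> arcs G. \<exists>i\<in>{1..s}. \<exists>j\<in>{1..s}. i < j \<and> tail G e \<in> P i \<and> head G e \<in> P j}"
    using D unfolding coherent_acyclic_def by (elim exE conjE) (rule that)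
  show eG: "e \<in> arcs G" using e Deq by auto
  have eq: "i = j" if "i \<in> {1..s}" "j \<in> {1..s}" "v \<in> P i" "v \<in> P j" for i j v
    using P that unfolding disjoint_family_on_def by blast
  show "arev e \<notin> D"
  proof
    assume "arev e \<in> D"
    then obtain k l where kl: "k \<in> {1..s}" "l \<in> {1..s}" "k < l" "head G e \<in> P k" "tail G e \<in> P l"
      using Deq eG by auto
    obtain i j where ij: "i \<in> {1..s}" "j \<in> {1..s}" "i < j" "tail G e \<in> P i" "head G e \<in> P j"
      using Deq e by auto
    show False using eq[OF ij(1) kl(2) ij(4) kl(5)] eq[OF ij(2) kl(1) ij(5) kl(4)] kl(3) ij(3) by simp
  qed
qed

text \<open>On \<open>D\<close> and its reverses the coordinates are fixed at \<open>1/2\<close> and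
  \<open>-1/2\<close>, which is the translation vector; it vanishes on the remaining arcs, where the
  coordinates range over the cube of \<open>H\<close>.\<close>

lemma cube_face_eq_translate:
  fixes G :: "('v, 'e::finite) pre_digraph"
  assumes G: "bidirected_digraph G arev" and D: "coherent_acyclic G D"
  shows "cube_face G arev D =
    (\<lambda>x. x + (1/2) *\<^sub>R orientation_char arev D) ` cube_face (remove_oriented G arev D) arev {}"
    (is "_ = ?t ` cube_face ?H arev {}")
proof -
  interpret bidirected_digraph G arev by fact
  note asym = coherent_acyclic_asym[OF G D]
  have char: "orientation_char arev D $ e = (if e \<in> D then 1 else if arev e \<in> D then - 1 else 0)" for e
    by (simp add: orientation_char_def)
  have arcsH: "e \<in> arcs ?H \<longleftrightarrow> e \<in> arcs G \<and> e \<notin> D \<and> arev e \<notin> D" for e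
    by (auto simp: remove_oriented_def image_iff intro: arev_arev[symmetric])
  \<comment> \<open>Outside \<open>arcs G\<close> the map \<open>arev\<close> is the identity, so
    neither case of \<open>orientation_char\<close> applies.\<close>
  have outside: "arev e \<notin> D" "e \<notin> D" if "e \<notin> arcs G" for e
    using that asym(1) arev_eq by auto
  have "?t x \<in> cube_face G arev D" if x: "x \<in> cube_face ?H arev {}" for x
  proof -
    have H: "x $ arev e = - x $ e" "\<bar>x $ e\<bar> \<le> 1/2" if "e \<in> arcs ?H" for e
      using x that by (auto simp: cube_face_def cochains1_def)
    have 0: "x $ e = 0" if "e \<notin> arcs ?H" for e
      using x that by (auto simp: cube_face_def cochains1_def)
    have "?t x $ arev e = - ?t x $ e" if "e \<in> arcs G" for e
      using that H(1)[of e] 0[of e] 0[of "arev e"] asym(2)[of e] by (auto simp: char arcsH)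
    moreover have "?t x $ e = 0" if "e \<notin> arcs G" for e
      using that 0[of e] outside[of e] by (auto simp: char arcsH)
    moreover have "?t x $ e = 1/2" if "e \<in> D" for e
      using that 0[of e] by (simp add: char arcsH)
    moreover have "\<bar>?t x $ e\<bar> \<le> 1/2" if "e \<in> arcs G" for e
      using that H(2)[of e] 0[of e] by (auto simp: char arcsH)
    ultimately show ?thesis by (auto simp: cube_face_def cochains1_def)
  qed
  moreover have "x - (1/2) *\<^sub>R orientation_char arev D \<in> cube_face ?H arev {}" (is "?x \<in> _")
    if x: "x \<in> cube_face G arev D" for x
  proof -
    have half: "x $ e = 1/2" if "e \<in> D" for e using x that by (auto simp: cube_face_def)
    have rev: "x $ arev e = - x $ e" if "e \<in> arcs G" for e
      using x that by (auto simp: cube_face_def cochains1_def)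
    have "?x $ e = 0" if "e \<notin> arcs ?H" for e
    proof (cases "e \<in> arcs G")
      case True
      then show ?thesis
        using that half[of e] half[of "arev e"] rev[of e] by (auto simp: char arcsH)
    next
      case False
      then show ?thesis
        using x outside[of e] by (auto simp: char cube_face_def cochains1_def)
    qed
    moreover have "?x $ e = x $ e" "?x $ arev e = x $ arev e" if "e \<in> arcs ?H" for e
      using that by (auto simp: arcsH char)
    ultimately show ?thesis
      using x by (auto simp: cube_face_def cochains1_def arcsH)
  qed
  ultimately show ?thesis by (force intro: image_eqI[where x = "_ - (1/2) *\<^sub>R _"])
qed

section \<open>The three claims about the face of the Voronoi cell\<close>

theorem theorem3p44:
  fixes G :: "('v, 'e::finite) pre_digraph"
    and arev :: "'e \<Rightarrow> 'e"
    and D :: "'e set"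
    and X :: "nat \<Rightarrow> ('v, 'e) pre_digraph"
    and d :: nat
  assumes "bidirected_digraph G arev"
    and "fin_digraph G"
    and "loopfree_digraph G"
    and "Digraph_Component.connected G"
    and "coherent_acyclic G D"
    and "bij_betw X {1..d+1} (components_of (remove_oriented G arev D))"
  shows "cut_projection G ` cube_face G arev D = voronoi_face G D
    \<and> cut_projection G ` rel_interior (cube_face G arev D) = rel_interior (voronoi_face G D)
    \<and> bij_betw (cut_projection G)
        ((\<Sum>i\<in>{1..d+1}. voronoi_cell (X i)) + {(1/2) *\<^sub>R orientation_char arev D})
        (voronoi_face G D)"
proof -
  interpret G: bidirected_digraph G arev by fact
  interpret fin_digraph G by fact
  interpret GR: reversible_digraph G arev
    by unfold_locales auto
  define H where "H = remove_oriented G arev D"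
  have HG: "verts H = verts G" "tail H = tail G" "head H = head G"
    "arcs H = arcs G - (D \<union> arev ` D)"
    by (simp_all add: H_def remove_oriented_def)
  have arevH: "arev e \<in> arcs H" if "e \<in> arcs H" for e
    using that unfolding HG(4) by (auto simp: image_iff) (metis G.arev_arev)+
  interpret HR: reversible_digraph H arev
    by unfold_locales (use arevH in \<open>auto simp: HG\<close>)
  define c where "c = (1/2) *\<^sub>R orientation_char arev D"
  have face: "cut_projection G ` cube_face G arev D = voronoi_face G D"
    by (rule GR.projection_cube_face) fact+
  have rel: "cut_projection G ` rel_interior (cube_face G arev D) = rel_interior (voronoi_face G D)"
    \<comment> \<open>The second claim follows from the first, since linear maps commute with
      relative interiors of convex sets.\<close>
    unfolding face[symmetric]
    by (rule rel_interior_convex_linear_image[OF linear_cut_projection convex_cube_face])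
  note X = HR.components_partition[OF assms(6)[folded H_def]]
  have "(\<Sum>i\<in>{1..d+1}. voronoi_cell (X i)) = (\<Sum>i\<in>{1..d+1}. voronoi_cell (H \<restriction> verts (X i)))"
    using X(1) by (intro sum.cong) auto
  also have "\<dots> = voronoi_cell H"
    using X by (intro voronoi_cell_eq_sum[symmetric] HR.wf_digraph_axioms) auto
  finally have S: "(\<Sum>i\<in>{1..d+1}. voronoi_cell (X i)) + {c} = (\<lambda>x. x + c) ` voronoi_cell H"
    by (auto simp: set_plus_def)
  have "inj_on (cut_projection G) ((\<lambda>x. x + c) ` voronoi_cell H)"
  proof -
    have "inj_on (cut_projection G) (voronoi_cell H)"
      by (rule inj_on_subset[OF inj_on_cut_projection_remove_oriented[of G arev D, folded H_def]])
        (auto simp: voronoi_cell_iff)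
    then show ?thesis
      by (auto simp: inj_on_def linear_add[OF linear_cut_projection])
  qed
  moreover have "cut_projection G ` (\<lambda>x. x + c) ` voronoi_cell H = voronoi_face G D"
  proof -
    \<comment> \<open>The cell of \<open>H\<close> is the projection of its cube, and that inner
      projection is absorbed by the outer one. So the cell may be replaced by the cube, whose
      translate by \<open>c\<close> is the cube face for \<open>D\<close>.\<close>
    have "cut_projection G (cut_projection H x + c) = cut_projection G (x + c)"
      if "x \<in> cube_face H arev {}" for x
      using that cut_projection_remove_oriented[of G arev D x, folded H_def]
      by (auto simp: linear_add[OF linear_cut_projection] cube_face_def cochains1_def)
    then have "cut_projection G ` (\<lambda>x. x + c) ` voronoi_cell H =
        cut_projection G ` (\<lambda>x. x + c) ` cube_face H arev {}"
      unfolding HR.projection_cube[symmetric] image_image by (rule image_cong[OF refl])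
    also have "\<dots> = cut_projection G ` cube_face G arev D"
      using cube_face_eq_translate[OF assms(1,5)] by (simp add: H_def c_def)
    finally show ?thesis by (simp add: face)
  qed
  ultimately have "bij_betw (cut_projection G)
      ((\<Sum>i\<in>{1..d+1}. voronoi_cell (X i)) + {(1/2) *\<^sub>R orientation_char arev D}) (voronoi_face G D)"
    unfolding bij_betw_def S[unfolded c_def] by (simp add: c_def)
  then show ?thesis using face rel by blast
qed

end
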